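(* Let $\mathcal B$ be a pseudometric betweenness on a set $V$ with $|V| = n \geq 2$. Then either $\mathcal B$ has a universal line or $\mathcal B$ has at least $(2^{-1/5} - o(1)) n^{2/5}$ distinct lines (the $o(1)$ term tending to $0$ as $n\to\infty$).
   Context: A ternary relation $\mathcal B \subseteq V^3$ on a finite set $V$ (write $[abc]$ for $(a,b,c) \in \mathcal B$) is a pseudometric betweenness if: (M0) if $[abc]$ then $a,b,c$ are distinct; (M1) if $[abc]$ then $[cba]$; (M2) if $[abc]$ then $[bac]$ does not hold; (M3) if $[abc]$ and $[acd]$ then $[abd]$ and $[bcd]$. A set $\{a,b,c\}$ of three distinct points is collinear if one of $[abc]$, $[bca]$, $[cab]$ holds. For distinct $a,b \in V$ the line generated by $a,b$ is $\overline{ab} = \{a,b\} \cup \{c : [abc], [acb], \text{ or } [cab]\}$. A line is universal if it equals $V$. *)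

theory Defs
  imports Complex_Main
begin

definition pseudometric_betweenness :: "'a set \<Rightarrow> ('a \<times> 'a \<times> 'a) set \<Rightarrow> bool" where
  "pseudometric_betweenness V B \<longleftrightarrow>
     finite V \<and>
     B \<subseteq> V \<times> V \<times> V \<and>
     (\<forall>a b c. (a, b, c) \<in> B \<longrightarrow> a \<noteq> b \<and> b \<noteq> c \<and> a \<noteq> c) \<and>
     (\<forall>a b c. (a, b, c) \<in> B \<longrightarrow> (c, b, a) \<in> B) \<and>
     (\<forall>a b c. (a, b, c) \<in> B \<longrightarrow> (b, a, c) \<notin> B) \<and>
     (\<forall>a b c d. (a, b, c) \<in> B \<and> (a, c, d) \<in> B \<longrightarrow> (a, b, d) \<in> B \<and> (b, c, d) \<in> B)"

definition line :: "('a \<times> 'a \<times> 'a) set \<Rightarrow> 'a \<Rightarrow> 'a \<Rightarrow> 'a set" where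
  "line B a b = {a, b} \<union> {c. (a, b, c) \<in> B \<or> (a, c, b) \<in> B \<or> (c, a, b) \<in> B}"

definition lines :: "'a set \<Rightarrow> ('a \<times> 'a \<times> 'a) set \<Rightarrow> 'a set set" where
  "lines V B = {line B a b | a b. a \<in> V \<and> b \<in> V \<and> a \<noteq> b}"

definition has_universal_line :: "'a set \<Rightarrow> ('a \<times> 'a \<times> 'a) set \<Rightarrow> bool" where
  "has_universal_line V B \<longleftrightarrow> V \<in> lines V B"

end

(* Fix a point x and let m be the number of lines. The other points y fall into at most m classes
   according to the line xy, and each class is partially ordered by y < z iff [xyz].

   Distinct points y, z of an antichain in a class satisfy [yxz], so no third point of the antichain
   lies on the line yz. An antichain of size t thus gives t(t-1)/2 distinct lines.

   In a chain y1 < y2 < ... in a class, pick for each i a point p off the line through yi and its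
   successor. The line p yi then avoids every later point of the chain, so a chain of size s gives
   s distinct lines.

   By Mirsky's theorem, each class has at most m (1 + sqrt (2m)) points, so n is at most
   1 + m^2 (1 + sqrt (2m)). *)

theory Submission
  imports Defs
begin

section \<open>Mirsky's bound for finite strict orders\<close>

text \<open>Induction on the chain bound: the minimal elements form an antichain, and removing them
  shortens every chain, because a chain among the remaining points can be prolonged downwards by a
  minimal element.\<close>

lemma card_le_chain_times_antichain:
  fixes t :: real and less :: "'a \<Rightarrow> 'a \<Rightarrow> bool"
  assumes "finite A"
    and irrefl: "\<And>a. a \<in> A \<Longrightarrow> \<not> less a a"
    and trans: "\<And>a b c. a \<in> A \<Longrightarrow> b \<in> A \<Longrightarrow> c \<in> A \<Longrightarrow> less a b \<Longrightarrow> less b c \<Longrightarrow> less a c"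
    and chain: "\<And>K. K \<subseteq> A \<Longrightarrow> (\<forall>a\<in>K. \<forall>b\<in>K. a \<noteq> b \<longrightarrow> less a b \<or> less b a) \<Longrightarrow> card K \<le> s"
    and antichain: "\<And>K. K \<subseteq> A \<Longrightarrow> (\<forall>a\<in>K. \<forall>b\<in>K. \<not> less a b) \<Longrightarrow> real (card K) \<le> t"
  shows "real (card A) \<le> real s * t"
  using assms
proof (induction s arbitrary: A)
  case 0
  have "A = {}"
  proof (rule ccontr)
    assume "A \<noteq> {}"
    then obtain a where "a \<in> A" by blast
    then have "card {a} \<le> 0" by (intro "0.prems"(4)) auto
    then show False by simp
  qed
  then show ?case by simp
next
  case (Suc s)
  define M where "M = {a \<in> A. \<forall>b\<in>A. \<not> less b a}"
  have below: "\<exists>b\<in>M. less b a" if "a \<in> A - M" for a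
    using that
  \<comment> \<open>Descent: passing to a smaller element strictly decreases the number of its
    predecessors, so it ends in \<open>M\<close>.\<close>
  proof (induction "card {b \<in> A. less b a}" arbitrary: a rule: less_induct)
    case less
    then obtain b where b: "b \<in> A" "less b a" by (auto simp: M_def)
    show ?case
    proof (cases "b \<in> M")
      case False
      have "{c \<in> A. less c b} \<subset> {c \<in> A. less c a}"
        using b less.prems Suc.prems(2,3) by blast
      then have "card {c \<in> A. less c b} < card {c \<in> A. less c a}"
        using \<open>finite A\<close> by (intro psubset_card_mono) auto
      with less.hyps b False obtain c where "c \<in> M" "less c b" by blast
      then show ?thesis
        using b less.prems Suc.prems(3)[of c b a] by (auto simp: M_def)
    qed (use b in blast)
  qed
  have "real (card (A - M)) \<le> real s * t"
  proof (rule Suc.IH)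
    fix K assume K: "K \<subseteq> A - M" "\<forall>a\<in>K. \<forall>b\<in>K. a \<noteq> b \<longrightarrow> less a b \<or> less b a"
    show "card K \<le> s"
    proof (cases "K = {}")
      case False
      have finK: "finite K" using K(1) \<open>finite A\<close> finite_subset by blast
      \<comment> \<open>A minimal element below the least element of \<open>K\<close> is below all
        of \<open>K\<close>, so adding it gives a chain with one more point.\<close>
      have "\<exists>a\<in>K. \<forall>b\<in>K. a \<noteq> b \<longrightarrow> less a b"
        using finK False K
      proof (induction rule: finite_ne_induct)
        case (insert a F)
        then obtain c where c: "c \<in> F" "\<forall>b\<in>F. c \<noteq> b \<longrightarrow> less c b" by auto
        have "less a c \<or> less c a" using insert c by (metis insertCI)
        then show ?case
        proof
          assume ac: "less a c"
          have "less a b" if "b \<in> F" for b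
            using c that ac Suc.prems(3)[of a c b] insert.prems(1)
            by (cases "b = c") auto
          then show ?thesis by blast
        qed (use c in auto)
      qed auto
      then obtain a where a: "a \<in> K" "\<forall>b\<in>K. a \<noteq> b \<longrightarrow> less a b" by blast
      obtain c where c: "c \<in> M" "less c a" using below a(1) K(1) by blast
      have cK: "less c b" if "b \<in> K" for b
        using a c that K(1) Suc.prems(3)[of c a b] by (cases "b = a") (auto simp: M_def)
      have "card (insert c K) \<le> Suc s"
        using K cK c(1) by (intro Suc.prems(4)) (auto simp: M_def)
      moreover have "c \<notin> K" using c(1) K(1) by blast
      ultimately show ?thesis using finK by simp
    qed simp
  qed (use Suc.prems in \<open>auto intro: Suc.prems(3,5)\<close>)
  moreover have "real (card M) \<le> t"
    by (rule Suc.prems(5)) (auto simp: M_def)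
  moreover have "card A = card M + card (A - M)"
    using \<open>finite A\<close> card_Un_disjoint[of M "A - M"] by (auto simp: M_def Un_absorb1)
  ultimately show ?case by (simp add: algebra_simps)
qed

section \<open>Betweenness axioms and elementary facts on lines\<close>

locale betweenness_no_universal_line =
  fixes V :: "'a set" and B :: "('a \<times> 'a \<times> 'a) set"
  assumes betweenness: "pseudometric_betweenness V B"
    and no_universal: "\<not> has_universal_line V B"
begin

abbreviation btw where "btw a b c \<equiv> (a, b, c) \<in> B"

lemma finite_V: "finite V"
  using betweenness by (simp add: pseudometric_betweenness_def)

lemma between_in_V: "btw a b c \<Longrightarrow> a \<in> V \<and> b \<in> V \<and> c \<in> V"
  using betweenness unfolding pseudometric_betweenness_def by blast

lemma between_distinct: "btw a b c \<Longrightarrow> a \<noteq> b \<and> b \<noteq> c \<and> a \<noteq> c"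
  using betweenness unfolding pseudometric_betweenness_def by blast

lemma between_sym: "btw a b c \<Longrightarrow> btw c b a"
  using betweenness unfolding pseudometric_betweenness_def by blast

text \<open>Axiom M3. Read from the base point \<open>a\<close>, the first part is transitivity of
  the order "\<open>b\<close> before \<open>c\<close> iff \<open>btw a b c\<close>"; the second part
  drops the base point.\<close>

lemma between_trans:
  assumes "btw a b c" "btw a c d"
  shows "btw a b d" "btw b c d"
  using betweenness assms unfolding pseudometric_betweenness_def by blast+

lemma line_subset_V: "a \<in> V \<Longrightarrow> b \<in> V \<Longrightarrow> line B a b \<subseteq> V"
  using between_in_V by (auto simp: line_def)

lemma line_in_lines: "a \<in> V \<Longrightarrow> b \<in> V \<Longrightarrow> a \<noteq> b \<Longrightarrow> line B a b \<in> lines V B"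
  by (auto simp: lines_def)

lemma finite_lines: "finite (lines V B)"
proof -
  have "lines V B \<subseteq> Pow V" using line_subset_V by (auto simp: lines_def)
  then show ?thesis using finite_V by (metis finite_Pow_iff finite_subset)
qed

text \<open>The absence of a universal line enters through this lemma.\<close>

lemma point_off_line:
  assumes "a \<in> V" "b \<in> V" "a \<noteq> b"
  obtains p where "p \<in> V" "p \<notin> line B a b"
proof -
  have "line B a b \<noteq> V"
    using line_in_lines[OF assms] no_universal by (auto simp: has_universal_line_def)
  then show ?thesis using line_subset_V[OF assms(1,2)] that by blast
qed

section \<open>Chains seen from a base point\<close>

text \<open>Here \<open>w\<close> is the successor of \<open>y\<close> in a chain seen from
  \<open>x\<close>, and \<open>v\<close> is any later point. If \<open>v\<close> were on the line
  \<open>p y\<close>, then in each position of \<open>v\<close> axiom M3 would make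
  \<open>p\<close>, \<open>y\<close>, \<open>w\<close> collinear or equate \<open>p\<close> with one
  of the others, against the choice of \<open>p\<close>.\<close>

lemma line_off_later_points:
  assumes xyw: "btw x y w" and p: "p \<in> V" "p \<notin> line B y w"
    and eq: "line B x y = line B x w"
    and xyv: "btw x y v" and v: "v = w \<or> btw x w v"
  shows "v \<notin> line B p y"
proof
  assume "v \<in> line B p y"
  have notin: "\<not> btw y w p" "\<not> btw y p w" "\<not> btw p y w" "p \<noteq> y" "p \<noteq> w"
    using p by (auto simp: line_def)
  have "v \<noteq> y" "v \<noteq> w \<longrightarrow> btw y w v"
    using between_distinct[OF xyv] between_trans(2) xyw v by blast+
  have "v \<noteq> w"
  proof
    assume "v = w"
    then consider "btw p y w" | "btw p w y" | "btw w p y"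
      using \<open>v \<in> line B p y\<close> notin(5) \<open>v \<noteq> y\<close> by (auto simp: line_def)
    then show False using notin between_sym by cases blast+
  qed
  then have xwv: "btw x w v" and ywv: "btw y w v"
    using v \<open>v \<noteq> w \<longrightarrow> btw y w v\<close> by auto
  show False
  proof (cases "v = p")
    case True
    then show ?thesis using ywv notin by blast
  next
    case False
    then consider "btw p y v" | "btw p v y" | "btw v p y"
      using \<open>v \<in> line B p y\<close> \<open>v \<noteq> y\<close> by (auto simp: line_def)
    then show ?thesis
    proof cases
      case 1
      then show ?thesis
        using between_trans(2)[of v w y p] ywv notin between_sym by blast
    next
      case 2
      then show ?thesis
        using between_trans(1)[of y w v p] ywv notin between_sym by blast
    next
      \<comment> \<open>Here \<open>p\<close> lies between \<open>y\<close> and \<open>v\<close>,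
        which gives \<open>btw x y p\<close>; \<open>eq\<close> then moves \<open>p\<close> to the
        line \<open>x w\<close>, and each of its three positions there puts it on the line
        \<open>y w\<close>.\<close>
      case 3
      then have xyp: "btw x y p"
        using between_trans(2)[of v p y x] xyv between_sym by blast
      then have "p \<in> line B x w" using eq by (auto simp: line_def)
      then consider "btw x w p" | "btw x p w" | "btw p x w"
        using notin between_distinct[OF xyp] by (auto simp: line_def)
      then show ?thesis
      proof cases
        case 1
        then show ?thesis using between_trans(2) xyw notin by blast
      next
        case 2
        then show ?thesis using between_trans(2) xyp notin by blast
      next
        case 3
        then show ?thesis
          using between_trans(1)[of w y x p] xyw notin between_sym by blast
      qed
    qed
  qed
qed

text \<open>Each point of the chain gets a line through it that misses all later points. Of two
  points, the later one lies on its own line but not on that of the earlier one, so these lines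
  differ.\<close>

lemma chain_card_le:
  assumes x: "x \<in> V" and K: "K \<subseteq> V - {x}"
    and eq: "\<And>y z. y \<in> K \<Longrightarrow> z \<in> K \<Longrightarrow> line B x y = line B x z"
    and chain: "\<forall>y\<in>K. \<forall>z\<in>K. y \<noteq> z \<longrightarrow> btw x y z \<or> btw x z y"
  shows "card K \<le> card (lines V B)"
proof -
  have finK: "finite K" using K finite_V finite_subset by blast
  have "\<exists>P \<in> lines V B. y \<in> P \<and> (\<forall>v\<in>K. btw x y v \<longrightarrow> v \<notin> P)" if y: "y \<in> K" for y
  proof (cases "\<exists>v\<in>K. btw x y v")
    \<comment> \<open>The last point has no later points to avoid, so any line through it
      serves.\<close>
    case False
    moreover have "y \<in> line B x y" by (simp add: line_def)
    ultimately show ?thesis using line_in_lines[of x y] x K y by blast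
  next
    case True
    \<comment> \<open>The successor of \<open>y\<close> is found as the point after \<open>y\<close>
      with the most later points: a point strictly between would have \<open>w\<close> as an
      additional later point.\<close>
    define later where "later u = {v \<in> K. btw x u v}" for u
    obtain w where w: "w \<in> K" "btw x y w"
      and w_max: "\<And>u. u \<in> K \<Longrightarrow> btw x y u \<Longrightarrow> card (later u) \<le> card (later w)"
    proof -
      have "finite (later y)" "later y \<noteq> {}" using finK True by (auto simp: later_def)
      then have "Max ((card \<circ> later) ` later y) \<in> (card \<circ> later) ` later y"
        by (intro Max_in) auto
      then obtain w where w: "w \<in> later y" "card (later w) = Max ((card \<circ> later) ` later y)"
        by auto
      have "card (later u) \<le> card (later w)" if "u \<in> later y" for u
        unfolding w(2) using that \<open>finite (later y)\<close> by (intro Max_ge) auto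
      then show ?thesis using that w(1) by (auto simp: later_def)
    qed
    have w_least: "v = w \<or> btw x w v" if v: "v \<in> K" "btw x y v" for v
    proof (rule ccontr)
      assume "\<not> (v = w \<or> btw x w v)"
      then have xvw: "btw x v w" using chain v(1) w(1) by blast
      have "later w \<subseteq> later v"
        using between_trans(1)[OF xvw] by (auto simp: later_def)
      moreover have "w \<in> later v - later w"
        using xvw w(1) between_distinct by (auto simp: later_def)
      ultimately have "later w \<subset> later v" by blast
      then have "card (later w) < card (later v)"
        using finK by (intro psubset_card_mono) (auto simp: later_def)
      then show False using w_max[OF v] by simp
    qed
    obtain p where p: "p \<in> V" "p \<notin> line B y w"
      using point_off_line[of y w] between_in_V[OF w(2)] between_distinct[OF w(2)] by metis
    have "line B p y \<in> lines V B"
      using p y K by (intro line_in_lines) (auto simp: line_def)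
    moreover have "y \<in> line B p y" by (simp add: line_def)
    moreover have "v \<notin> line B p y" if "v \<in> K" "btw x y v" for v
      using line_off_later_points[OF w(2) p eq[OF y w(1)] that(2) w_least[OF that]] .
    ultimately show ?thesis by blast
  qed
  then obtain P where P: "\<And>y. y \<in> K \<Longrightarrow> P y \<in> lines V B" "\<And>y. y \<in> K \<Longrightarrow> y \<in> P y"
      "\<And>y v. y \<in> K \<Longrightarrow> v \<in> K \<Longrightarrow> btw x y v \<Longrightarrow> v \<notin> P y"
    by metis
  have "inj_on P K" using chain P(2,3) by (metis inj_onI)
  then show ?thesis using P(1) finite_lines by (intro card_inj_on_le) auto
qed

section \<open>Antichains seen from a base point\<close>

text \<open>The pairs in \<open>A\<close> are exactly cut out by lines, so there are at least
  \<open>card A choose 2\<close> lines.\<close>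

lemma antichain_card_le:
  assumes A: "A \<subseteq> V - {x}"
    and eq: "\<And>y z. y \<in> A \<Longrightarrow> z \<in> A \<Longrightarrow> line B x y = line B x z"
    and antichain: "\<forall>y\<in>A. \<forall>z\<in>A. \<not> btw x y z"
  shows "real (card A) \<le> 1 + sqrt (2 * card (lines V B))"
proof -
  have finA: "finite A" using A finite_V finite_subset by blast
  \<comment> \<open>Since \<open>z\<close> is on the line \<open>x y\<close> and the antichain
    condition excludes two of the positions, \<open>x\<close> must lie between.\<close>
  have star: "btw y x z" if "y \<in> A" "z \<in> A" "y \<noteq> z" for y z
  proof -
    have "z \<in> line B x y" using eq[OF that(1,2)] by (simp add: line_def)
    then have "btw x y z \<or> btw x z y \<or> btw z x y"
      using that A by (auto simp: line_def)
    then show ?thesis using that antichain between_sym by blast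
  qed
  \<comment> \<open>By \<open>star\<close>, \<open>btw y x z\<close>; together with
    \<open>btw y z w\<close>, M3 yields the comparison \<open>btw x z w\<close>.\<close>
  have not_between: False if "y \<in> A" "z \<in> A" "w \<in> A" "btw y z w" for y z w
  proof -
    have "btw x z w"
      using star[of y z] that between_distinct[OF that(4)] between_trans(2) by blast
    then show False using antichain that by blast
  qed
  have line_Int: "line B y z \<inter> A = {y, z}" if "y \<in> A" "z \<in> A" for y z
    using that not_between by (auto simp: line_def)
  have "{P. P \<subseteq> A \<and> card P = 2} \<subseteq> (\<lambda>L. L \<inter> A) ` lines V B"
  proof
    fix P assume "P \<in> {P. P \<subseteq> A \<and> card P = 2}"
    then obtain y z where P: "P = {y, z}" "y \<noteq> z" "y \<in> A" "z \<in> A"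
      by (auto simp: card_2_iff)
    then have "P = line B y z \<inter> A" using line_Int by blast
    moreover have "line B y z \<in> lines V B" using P A by (intro line_in_lines) auto
    ultimately show "P \<in> (\<lambda>L. L \<inter> A) ` lines V B" by blast
  qed
  then have "card A choose 2 \<le> card (lines V B)"
    using surj_card_le[OF finite_lines] n_subsets[OF finA, of 2] by metis
  moreover have "real (card A choose 2) = real (card A) * (real (card A) - 1) / 2"
    by (cases "card A = 0") (auto simp: choose_two real_of_nat_div)
  ultimately have *: "real (card A) * (real (card A) - 1) \<le> 2 * card (lines V B)"
    by linarith
  show ?thesis
  proof (cases "card A = 0")
    case False
    \<comment> \<open>A convenient substitute for solving the quadratic; it fails for the empty
      antichain, hence the case split.\<close>
    then have "(real (card A) - 1)\<^sup>2 \<le> real (card A) * (real (card A) - 1)"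
      by (simp add: power2_eq_square mult_right_mono)
    then have "real (card A) - 1 \<le> sqrt (2 * card (lines V B))"
      using * by (intro real_le_rsqrt) linarith
    then show ?thesis by linarith
  qed simp
qed

section \<open>Counting points and inverting the bound\<close>

text \<open>The summand 1 accounts for the base point \<open>x\<close>; one factor \<open>m\<close>
  counts the classes and the other bounds the chains.\<close>

lemma card_points_le:
  assumes "V \<noteq> {}"
  shows "real (card V) \<le> 1 + (card (lines V B))\<^sup>2 * (1 + sqrt (2 * card (lines V B)))"
proof -
  define m where "m = card (lines V B)"
  define t where "t = 1 + sqrt (2 * m)"
  obtain x where x: "x \<in> V" using assms by blast
  have cls: "real (card {y \<in> V - {x}. line B x y = L}) \<le> real m * t" for L
  proof (rule card_le_chain_times_antichain[where less = "\<lambda>y z. btw x y z"])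
    fix K assume K: "K \<subseteq> {y \<in> V - {x}. line B x y = L}"
    show "card K \<le> m" if "\<forall>y\<in>K. \<forall>z\<in>K. y \<noteq> z \<longrightarrow> btw x y z \<or> btw x z y"
      unfolding m_def using K that by (intro chain_card_le[OF x]) auto
    show "real (card K) \<le> t" if "\<forall>y\<in>K. \<forall>z\<in>K. \<not> btw x y z"
      unfolding t_def m_def using K that by (intro antichain_card_le[of _ x]) auto
  qed (use finite_V between_distinct between_trans(1) in auto)
  have "V - {x} = (\<Union>L\<in>lines V B. {y \<in> V - {x}. line B x y = L})"
    using line_in_lines x by auto
  then have "card (V - {x}) \<le> (\<Sum>L\<in>lines V B. card {y \<in> V - {x}. line B x y = L})"
    by (rule ord_eq_le_trans[OF arg_cong[where f = card] card_UN_le[OF finite_lines]])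
  then have "real (card (V - {x})) \<le> (\<Sum>L\<in>lines V B. real (card {y \<in> V - {x}. line B x y = L}))"
    by (simp only: of_nat_sum[symmetric] of_nat_le_iff)
  also have "\<dots> \<le> (\<Sum>L\<in>lines V B. real m * t)"
    by (intro sum_mono cls)
  also have "\<dots> = (real m)\<^sup>2 * t"
    by (simp add: m_def power2_eq_square)
  finally have "real (card (V - {x})) \<le> (real m)\<^sup>2 * t" .
  moreover have "card V = Suc (card (V - {x}))"
    using x finite_V by (metis card_Suc_Diff1)
  ultimately show ?thesis by (simp add: m_def t_def)
qed

end

text \<open>The number \<open>u\<close> solves the equation given by the leading term, with
  \<open>u\<close> in place of \<open>sqrt m\<close>. The lower-order terms cost only a shift by
  \<open>sqrt 2\<close>: \<open>u \<le> sqrt m + sqrt 2\<close>, which is then squared.\<close>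

lemma lower_bound_of_card_bound:
  fixes m n u :: real
  assumes "m \<ge> 1" and n: "n \<le> 1 + m\<^sup>2 * (1 + sqrt (2 * m))"
    and u: "u \<ge> 0" "sqrt 2 * u ^ 5 = n"
  shows "u\<^sup>2 - 2 * sqrt 2 * u \<le> m"
proof -
  define r where "r = sqrt m"
  have r: "r \<ge> 0" "m = r\<^sup>2" using assms(1) by (auto simp: r_def)
  \<comment> \<open>This absorbs the summand 1, leaving a multiple of
    \<open>r ^ 4 * (r + sqrt 2)\<close>, which is at most a fifth power.\<close>
  have "1 \<le> m\<^sup>2" using assms(1) by (rule one_le_power)
  then have "n \<le> 2 * m\<^sup>2 + m\<^sup>2 * (sqrt 2 * r)"
    using n by (simp add: r_def real_sqrt_mult algebra_simps)
  also have "\<dots> = sqrt 2 * (r ^ 4 * (r + sqrt 2))"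
    by (simp add: r(2) algebra_simps flip: power_mult)
  also have "\<dots> \<le> sqrt 2 * ((r + sqrt 2) ^ 4 * (r + sqrt 2))"
    using r(1) by (intro mult_left_mono mult_right_mono power_mono) auto
  also have "\<dots> = sqrt 2 * (r + sqrt 2) ^ 5"
    by (simp add: eval_nat_numeral)
  finally have "sqrt 2 * u ^ 5 \<le> sqrt 2 * (r + sqrt 2) ^ 5" using u(2) by simp
  then have "u ^ 5 \<le> (r + sqrt 2) ^ 5" by (rule mult_left_le_imp_le) simp
  then have ur: "u - sqrt 2 \<le> r"
    using r(1) power_le_imp_le_base[of u 4 "r + sqrt 2"] by simp
  show ?thesis
  proof (cases "u \<ge> sqrt 2")
    case True
    then have "(u - sqrt 2)\<^sup>2 \<le> r\<^sup>2" using ur by (intro power_mono) auto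
    then show ?thesis using r(2) by (simp add: power2_diff mult_ac)
  next
    \<comment> \<open>Now \<open>u - sqrt 2\<close> is negative and cannot be squared, but the
      claimed lower bound is itself at most 0.\<close>
    case False
    then have "u * u \<le> u * (2 * sqrt 2)" using u(1) by (intro mult_left_mono) auto
    then show ?thesis using assms(1) by (simp add: power2_eq_square algebra_simps)
  qed
qed

theorem mainTheorem2:
  shows "\<exists>\<epsilon> :: nat \<Rightarrow> real. \<epsilon> \<longlonglongrightarrow> 0 \<and>
    (\<forall>(V :: 'a set) (B :: ('a \<times> 'a \<times> 'a) set) (n :: nat).
       pseudometric_betweenness V B \<and> card V = n \<and> n \<ge> 2 \<longrightarrow>
       has_universal_line V B \<or>
       real (card (lines V B)) \<ge> (2 powr (- 1 / 5) - \<epsilon> n) * real n powr (2 / 5))"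
proof -
  \<comment> \<open>Chosen so that the error \<open>2 * sqrt 2 * u\<close>, with \<open>u\<close> as
    below, equals \<open>c\<close> times the fifth root of \<open>n\<close>; dividing by
    \<open>n powr (2 / 5)\<close> gives \<open>\<epsilon> n\<close>.\<close>
  define c :: real where "c = 2 * sqrt 2 * 2 powr (- 1 / 10)"
  define \<epsilon> where "\<epsilon> n = c * real n powr (- 1 / 5)" for n
  have "(\<lambda>n. real n powr (- 1 / 5)) \<longlonglongrightarrow> 0"
    by (intro tendsto_neg_powr filterlim_real_sequentially) auto
  then have "\<epsilon> \<longlonglongrightarrow> 0"
    unfolding \<epsilon>_def by (rule tendsto_mult_right_zero)
  moreover have "(2 powr (- 1 / 5) - \<epsilon> n) * real n powr (2 / 5) \<le> card (lines V B)"
    if pb: "pseudometric_betweenness V B" and cardV: "card V = n" and n: "n \<ge> 2"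
      and no_universal: "\<not> has_universal_line V B"
    for V :: "'a set" and B :: "('a \<times> 'a \<times> 'a) set" and n
  proof -
    interpret betweenness_no_universal_line V B
      using pb no_universal by unfold_locales
    obtain a b where "a \<in> V" "b \<in> V" "a \<noteq> b"
      using cardV n by (metis card_le_Suc0_iff_eq finite_V not_less_eq_eq numeral_2_eq_2)
    then have "V \<noteq> {}" "lines V B \<noteq> {}" using line_in_lines by blast+
    then have m: "real (card (lines V B)) \<ge> 1"
      using finite_lines by (simp add: Suc_leI card_gt_0_iff)
    \<comment> \<open>The nonnegative root of \<open>sqrt 2 * u ^ 5 = n\<close>; its square is the
      main term of the bound.\<close>
    define u where "u = 2 powr (- 1 / 10) * real n powr (1 / 5)"
    have "u ^ 5 = 2 powr (- 1 / 2) * real n"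
      using n by (simp add: u_def power_mult_distrib powr_powr flip: powr_numeral)
    moreover have "sqrt 2 * 2 powr (- 1 / 2) = (1 :: real)"
      by (simp add: powr_half_sqrt[symmetric] flip: powr_add)
    ultimately have u5: "sqrt 2 * u ^ 5 = real n"
      by (metis mult.assoc mult_1)
    have "u\<^sup>2 - 2 * sqrt 2 * u \<le> card (lines V B)"
      using card_points_le[OF \<open>V \<noteq> {}\<close>] cardV m u5
      by (intro lower_bound_of_card_bound[where n = "real n"]) (auto simp: u_def)
    moreover have "u\<^sup>2 = 2 powr (- 1 / 5) * real n powr (2 / 5)"
      by (simp add: u_def power_mult_distrib powr_powr flip: powr_numeral)
    moreover have "2 * sqrt 2 * u = \<epsilon> n * real n powr (2 / 5)"
      by (simp add: u_def \<epsilon>_def c_def mult.assoc flip: powr_add)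
    ultimately show ?thesis by (simp add: left_diff_distrib)
  qed
  ultimately show ?thesis by blast
qed

end
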